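(* For every $\epsilon>0$ there is a constant $C>0$ such that for all $f\in L^{4/3}(\mathbb{H},|z_2|^{-\epsilon})$ and all $\lambda>0$, $$\left|\{(z_1,z_2)\in\mathbb{H} : |P(f)(z_1,z_2)|>\lambda\}\right| \le \frac{C\,\|f\|^{4/3}_{L^{4/3}(\mathbb{H},|z_2|^{-\epsilon})}}{\lambda^{4/3}}.$$
   Context: $\mathbb{H}=\{(z_1,z_2)\in\mathbb{C}^2:|z_1|<|z_2|<1\}$, $dV$ Lebesgue measure, $|U|$ Lebesgue measure of $U$. The Bergman projection is $P(f)(z)=\int_{\mathbb{H}}K_{\mathbb{H}}(z;\bar w)f(w)\,dV(w)$, $K_{\mathbb{H}}(z_1,z_2;\bar w_1,\bar w_2)=\frac{1}{\pi^2 z_2\bar w_2(1-\frac{z_1\bar w_1}{z_2\bar w_2})^2(1-z_2\bar w_2)^2}$. For a positive weight $\mu$, $\|f\|^p_{L^p(\mathbb{H},\mu)}=\int_{\mathbb{H}}|f|^p\mu\,dV$. *)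

theory Defs
  imports "HOL-Analysis.Analysis"
begin

definition hartogs :: "(complex \<times> complex) set" where
  "hartogs = {(z1, z2). norm z1 < norm z2 \<and> norm z2 < 1}"

definition hartogs_kernel :: "complex \<times> complex \<Rightarrow> complex \<times> complex \<Rightarrow> complex" where
  "hartogs_kernel z w =
     1 / (complex_of_real (pi ^ 2) * snd z * cnj (snd w)
          * (1 - (fst z * cnj (fst w)) / (snd z * cnj (snd w))) ^ 2
          * (1 - snd z * cnj (snd w)) ^ 2)"

definition bergman_proj :: "(complex \<times> complex \<Rightarrow> complex) \<Rightarrow> complex \<times> complex \<Rightarrow> complex" where
  "bergman_proj f z = set_lebesgue_integral lebesgue hartogs (\<lambda>w. hartogs_kernel z w * f w)"

definition weighted_Lp_pow :: "real \<Rightarrow> (complex \<times> complex \<Rightarrow> real) \<Rightarrow> (complex \<times> complex \<Rightarrow> complex) \<Rightarrow> ennreal" where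
  "weighted_Lp_pow p \<mu> f = (\<integral>\<^sup>+ w\<in>hartogs. ennreal (norm (f w) powr p * \<mu> w) \<partial>lebesgue)"

end

theory Submission
  imports Defs "HOL-Complex_Analysis.Cauchy_Integral_Formula"
begin

text \<open>
  Only the absolute value of the kernel matters. On the Hartogs triangle it is a product of
  two disc kernels in the variables \<open>w\<^sub>1 / w\<^sub>2\<close> and \<open>w\<^sub>2\<close>, times \<open>1 / \<bar>z\<^sub>2 w\<^sub>2\<bar>\<close>, and Schur's test
  applies with products of powers of \<open>\<bar>w\<^sub>2\<bar>\<close>, \<open>1 - \<bar>w\<^sub>1 / w\<^sub>2\<bar>\<^sup>2\<close> and \<open>1 - \<bar>w\<^sub>2\<bar>\<^sup>2\<close> as test functions. The
  required disc integrals are averaged over rotations, which turns \<open>1 / \<bar>1 - a cnj w\<bar>\<^sup>2\<close> into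
  \<open>1 / (1 - \<bar>a\<bar>\<^sup>2 \<bar>w\<bar>\<^sup>2)\<close> by Cauchy's formula and leaves an integral over the unit interval.
  The weight \<open>\<bar>z\<^sub>2\<bar> powr (-\<epsilon>)\<close> makes the power of \<open>\<bar>w\<^sub>2\<bar>\<close> in the critical case \<open>p = 4/3\<close> integrable at the origin.
\<close>

section \<open>Rotations and radial integrals in the complex plane\<close>

lemma measurable_Complex[measurable]:
  "(\<lambda>(x, y). Complex x y) \<in> borel_measurable (borel \<Otimes>\<^sub>M borel)"
  unfolding Complex_eq case_prod_unfold by measurable

text \<open>Lebesgue measure is determined by its values on boxes, and in the basis
  \<open>1\<close>, \<open>\<i>\<close> a box is a product of two intervals. This makes Fubini in
  real and imaginary part available.\<close>

lemma lborel_complex_eq: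
  "(lborel :: complex measure) = distr (lborel \<Otimes>\<^sub>M lborel) borel (\<lambda>(x, y). Complex x y)"
proof (rule lborel_eqI)
  fix l u :: complex
  assume le: "\<And>b. b \<in> Basis \<Longrightarrow> l \<bullet> b \<le> u \<bullet> b"
  have le': "Re l \<le> Re u" "Im l \<le> Im u"
    using le[of 1] le[of \<i>] by (auto simp: Basis_complex_def)
  have "(\<lambda>(x, y). Complex x y) -` box l u \<inter> space (lborel \<Otimes>\<^sub>M lborel)
        = {Re l<..<Re u} \<times> {Im l<..<Im u}"
    by (auto simp: box_def Basis_complex_def space_pair_measure)
  then have "emeasure (distr (lborel \<Otimes>\<^sub>M lborel) borel (\<lambda>(x, y). Complex x y)) (box l u)
        = emeasure lborel {Re l<..<Re u} * emeasure lborel {Im l<..<Im u}"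
    by (subst emeasure_distr) (auto simp: lborel.emeasure_pair_measure_Times)
  also have "\<dots> = ennreal ((Re u - Re l) * (Im u - Im l))"
    using le' by (simp add: ennreal_mult)
  also have "(Re u - Re l) * (Im u - Im l) = (\<Prod>b\<in>Basis. (u - l) \<bullet> b)"
    by (simp add: Basis_complex_def)
  finally show "emeasure (distr (lborel \<Otimes>\<^sub>M lborel) borel (\<lambda>(x, y). Complex x y)) (box l u)
      = ennreal (\<Prod>b\<in>Basis. (u - l) \<bullet> b)" .
qed simp

lemma nn_integral_complex:
  assumes [measurable]: "F \<in> borel_measurable borel"
  shows "(\<integral>\<^sup>+w. F w \<partial>lborel) = (\<integral>\<^sup>+y. \<integral>\<^sup>+x. F (Complex x y) \<partial>lborel \<partial>lborel)"
    and "(\<integral>\<^sup>+w. F w \<partial>lborel) = (\<integral>\<^sup>+x. \<integral>\<^sup>+y. F (Complex x y) \<partial>lborel \<partial>lborel)"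
proof -
  have [measurable]: "(\<lambda>(x, y). F (Complex x y)) \<in> borel_measurable (borel \<Otimes>\<^sub>M borel)"
    using measurable_compose[OF measurable_Complex assms] by (simp add: case_prod_unfold)
  have "(\<integral>\<^sup>+w. F w \<partial>lborel) = (\<integral>\<^sup>+p. F (case p of (x, y) \<Rightarrow> Complex x y) \<partial>(lborel \<Otimes>\<^sub>M lborel))"
    by (subst lborel_complex_eq, subst nn_integral_distr) auto
  also have "\<dots> = (\<integral>\<^sup>+p. (case p of (x, y) \<Rightarrow> F (Complex x y)) \<partial>(lborel \<Otimes>\<^sub>M lborel))"
    by (simp add: case_prod_unfold)
  finally have *: "(\<integral>\<^sup>+w. F w \<partial>lborel) = \<dots>" .
  show "(\<integral>\<^sup>+w. F w \<partial>lborel) = (\<integral>\<^sup>+y. \<integral>\<^sup>+x. F (Complex x y) \<partial>lborel \<partial>lborel)"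
    unfolding * by (rule lborel_pair.nn_integral_snd[symmetric, of "\<lambda>(x, y). F (Complex x y)", simplified])
  show "(\<integral>\<^sup>+w. F w \<partial>lborel) = (\<integral>\<^sup>+x. \<integral>\<^sup>+y. F (Complex x y) \<partial>lborel \<partial>lborel)"
    unfolding * by (subst lborel.nn_integral_fst[symmetric]) simp_all
qed

text \<open>With one coordinate fixed, a shear only translates the other. Each part uses the order
  of integration in which the translated coordinate is the inner variable.\<close>

lemma nn_integral_complex_shear:
  fixes t :: real
  assumes [measurable]: "F \<in> borel_measurable borel"
  shows "(\<integral>\<^sup>+w. F (Complex (Re w + t * Im w) (Im w)) \<partial>lborel) = (\<integral>\<^sup>+w. F w \<partial>lborel)"
    and "(\<integral>\<^sup>+w. F (Complex (Re w) (Im w + t * Re w)) \<partial>lborel) = (\<integral>\<^sup>+w. F w \<partial>lborel)"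
proof -
  have [measurable]: "(\<lambda>w. Complex (Re w + t * Im w) (Im w)) \<in> borel_measurable borel"
     "(\<lambda>w. Complex (Re w) (Im w + t * Re w)) \<in> borel_measurable borel"
     "\<And>y. (\<lambda>x. Complex x y) \<in> borel_measurable borel" "\<And>x. (\<lambda>y. Complex x y) \<in> borel_measurable borel"
    unfolding Complex_eq by measurable
  have "(\<integral>\<^sup>+x. F (Complex (x + t * y) y) \<partial>lborel) = (\<integral>\<^sup>+x. F (Complex x y) \<partial>lborel)" for y
    by (subst (2) nn_integral_real_affine[where c=1 and t="t * y"]) (auto simp: add.commute)
  then show "(\<integral>\<^sup>+w. F (Complex (Re w + t * Im w) (Im w)) \<partial>lborel) = (\<integral>\<^sup>+w. F w \<partial>lborel)"
    by (simp add: nn_integral_complex(1))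
  have "(\<integral>\<^sup>+y. F (Complex x (y + t * x)) \<partial>lborel) = (\<integral>\<^sup>+y. F (Complex x y) \<partial>lborel)" for x
    by (subst (2) nn_integral_real_affine[where c=1 and t="t * x"]) (auto simp: add.commute)
  then show "(\<integral>\<^sup>+w. F (Complex (Re w) (Im w + t * Re w)) \<partial>lborel) = (\<integral>\<^sup>+w. F w \<partial>lborel)"
    by (simp add: nn_integral_complex(2))
qed

text \<open>A rotation other than \<open>w \<mapsto> -w\<close> is a product of three shears; \<open>-1\<close> is the square of \<open>\<i>\<close>.\<close>

lemma nn_integral_complex_rotate:
  fixes u :: complex
  assumes F: "F \<in> borel_measurable borel" and u: "norm u = 1"
  shows "(\<integral>\<^sup>+w. F (u * w) \<partial>lborel) = (\<integral>\<^sup>+w. F w \<partial>lborel)"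
proof -
  have *: "(\<integral>\<^sup>+w. F (u * w) \<partial>lborel) = (\<integral>\<^sup>+w. F w \<partial>lborel)"
    if [measurable]: "F \<in> borel_measurable borel" and u: "norm u = 1" "u \<noteq> -1" for u :: complex and F
  proof -
    define c s where "c = Re u" and "s = Im u"
    have cs: "c\<^sup>2 + s\<^sup>2 = 1"
      using u(1) by (simp add: c_def s_def cmod_def)
    have c: "1 + c \<noteq> 0"
    proof
      assume "1 + c = 0"
      then have "c = -1" by simp
      with cs have "s = 0" by simp
      with \<open>c = -1\<close> u(2) show False by (simp add: c_def s_def complex_eq_iff)
    qed
    \<comment> \<open>If \<open>u\<close> has argument \<theta>, then \<open>t\<close> is minus the
      tangent of \<theta>/2. This is the coefficient of the two outer shears, with \<open>s\<close>
      in the middle one; it is undefined exactly at \<open>u = -1\<close>.\<close>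
    define t where "t = - (s / (1 + c))"
    define S1 S2 where "S1 = (\<lambda>w. Complex (Re w + t * Im w) (Im w))"
      and "S2 = (\<lambda>w. Complex (Re w) (Im w + s * Re w))"
    have [measurable]: "S1 \<in> borel_measurable borel" "S2 \<in> borel_measurable borel"
      unfolding S1_def S2_def complex_eq by measurable
    have st: "s * t = c - 1" and tc: "t * (1 + c) = - s"
      using c cs by (auto simp: t_def field_simps power2_eq_square)
    have "u * w = S1 (S2 (S1 w))" for w
    proof (rule complex_eqI)
      have "Re (S1 (S2 (S1 w))) = (1 + s * t) * Re w + t * (2 + s * t) * Im w"
        by (simp add: S1_def S2_def algebra_simps)
      also have "\<dots> = c * Re w + t * (1 + c) * Im w"
        by (simp add: st)
      also have "\<dots> = c * Re w - s * Im w"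
        by (simp only: tc)
      finally show "Re (u * w) = Re (S1 (S2 (S1 w)))"
        by (simp add: c_def s_def)
      have "Im (S1 (S2 (S1 w))) = s * Re w + (1 + s * t) * Im w"
        by (simp add: S1_def S2_def algebra_simps)
      also have "\<dots> = s * Re w + c * Im w"
        by (simp add: st)
      finally show "Im (u * w) = Im (S1 (S2 (S1 w)))"
        by (simp add: c_def s_def)
    qed
    then have "(\<integral>\<^sup>+w. F (u * w) \<partial>lborel) = (\<integral>\<^sup>+w. F (S1 (S2 (S1 w))) \<partial>lborel)"
      by simp
    also have "\<dots> = (\<integral>\<^sup>+w. F (S1 (S2 w)) \<partial>lborel)"
      using nn_integral_complex_shear(1)[of "\<lambda>w. F (S1 (S2 w))" t] by (simp add: S1_def)
    also have "\<dots> = (\<integral>\<^sup>+w. F (S1 w) \<partial>lborel)"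
      using nn_integral_complex_shear(2)[of "\<lambda>w. F (S1 w)" s] by (simp add: S2_def)
    also have "\<dots> = (\<integral>\<^sup>+w. F w \<partial>lborel)"
      using nn_integral_complex_shear(1)[of F t] by (simp add: S1_def)
    finally show ?thesis .
  qed
  show ?thesis
  proof (cases "u = -1")
    case True
    have i: "norm \<i> = 1" "\<i> \<noteq> -1"
      by (auto simp: complex_eq_iff)
    have "(\<integral>\<^sup>+w. F (u * w) \<partial>lborel) = (\<integral>\<^sup>+w. F (\<i> * (\<i> * w)) \<partial>lborel)"
      by (simp add: True flip: mult.assoc)
    also have "\<dots> = (\<integral>\<^sup>+w. F w \<partial>lborel)"
      using *[OF _ i, of "\<lambda>w. F (\<i> * w)"] *[OF F i] F by simp
    finally show ?thesis .
  qed (use * F u in blast)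
qed

text \<open>On the unit circle the conjugate of \<open>e t\<close> is its inverse, so
  \<open>1 / (norm (1 - a * e t))\<^sup>2\<close> equals
  \<open>e t / ((1 - a * e t) * (e t - cnj a))\<close>. This is the integrand of Cauchy's formula at
  the interior point \<open>cnj a\<close> for the function \<open>1 / (1 - a * u)\<close>, which is
  holomorphic near the closed disc.\<close>

lemma nn_integral_poisson:
  fixes a :: complex
  assumes a: "norm a < 1"
  shows "(\<integral>\<^sup>+t\<in>{0..1}. ennreal (1 / (norm (1 - a * exp (2 * of_real pi * \<i> * of_real t)))\<^sup>2) \<partial>lborel)
         = ennreal (1 / (1 - (norm a)\<^sup>2))"
proof -
  define e :: "real \<Rightarrow> complex" where "e t = exp (2 * of_real pi * \<i> * of_real t)" for t
  have ne: "norm (e t) = 1" for t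
    by (simp add: e_def)
  have ce: "circlepath 0 1 t = e t" for t
    by (simp add: circlepath e_def)
  have nz: "1 - a * x \<noteq> 0" if "norm x \<le> 1" for x
  proof
    assume "1 - a * x = 0"
    then have "norm (a * x) = 1" by simp
    moreover have "norm (a * x) \<le> norm a * 1"
      using that by (simp only: norm_mult mult_left_mono norm_ge_zero)
    ultimately show False using a by simp
  qed
  have "((\<lambda>u. (1 / (1 - a * u)) / (u - cnj a)) has_contour_integral
          (2 * of_real pi * \<i> * (1 / (1 - a * cnj a)))) (circlepath 0 1)"
    by (rule Cauchy_integral_circlepath)
       (use a nz in \<open>auto intro!: continuous_intros holomorphic_intros\<close>)
  then have "((\<lambda>t. (1 / (1 - a * e t)) / (e t - cnj a) * (2 * of_real pi * \<i> * e t)) has_integral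
          (2 * of_real pi * \<i> * (1 / (1 - a * cnj a)))) {0..1}"
    unfolding has_contour_integral_def
    by (rule has_integral_eq[rotated])
       (simp add: vector_derivative_circlepath01 ce, simp add: e_def)
  then have "((\<lambda>t. inverse (2 * of_real pi * \<i>) * ((1 / (1 - a * e t)) / (e t - cnj a) * (2 * of_real pi * \<i> * e t))) has_integral
          (inverse (2 * of_real pi * \<i>) * (2 * of_real pi * \<i> * (1 / (1 - a * cnj a))))) {0..1}"
    by (rule has_integral_mult_right)
  also have "(\<lambda>t. inverse (2 * of_real pi * \<i>) * ((1 / (1 - a * e t)) / (e t - cnj a) * (2 * of_real pi * \<i> * e t)))
      = (\<lambda>t. of_real (1 / (norm (1 - a * e t))\<^sup>2))"
  proof
    fix t
    have "e t * cnj (e t) = 1"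
      by (simp add: ne flip: complex_norm_square)
    then have "e t - cnj a = e t * cnj (1 - a * e t)"
      by (simp add: algebra_simps)
    then have "(1 / (1 - a * e t)) / (e t - cnj a) * e t = 1 / ((1 - a * e t) * cnj (1 - a * e t))"
      using ne[of t] by auto
    also have "\<dots> = of_real (1 / (norm (1 - a * e t))\<^sup>2)"
      by (simp only: complex_norm_square[symmetric] of_real_divide of_real_1)
    finally show "inverse (2 * of_real pi * \<i>) * ((1 / (1 - a * e t)) / (e t - cnj a) * (2 * of_real pi * \<i> * e t))
      = of_real (1 / (norm (1 - a * e t))\<^sup>2)"
      by (simp add: field_simps)
  qed
  also have "inverse (2 * of_real pi * \<i>) * (2 * of_real pi * \<i> * (1 / (1 - a * cnj a))) = of_real (1 / (1 - (norm a)\<^sup>2))"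
    by (simp add: complex_norm_square[symmetric] field_simps)
  finally have "((\<lambda>t. 1 / (norm (1 - a * e t))\<^sup>2) has_integral (1 / (1 - (norm a)\<^sup>2))) {0..1}"
    by (drule_tac has_integral_Re) (simp only: Re_complex_of_real)
  then show ?thesis
    by (intro nn_integral_has_integral_lebesgue') (auto simp: e_def)
qed

text \<open>By rotation invariance \<open>w\<close> may be replaced by \<open>e t * w\<close> and
  the result averaged over \<open>t\<close>. The radial factor is unaffected, and the kernel
  averages to the value from \<open>nn_integral_poisson\<close>. That lemma needs
  \<open>norm a * norm w < 1\<close>; elsewhere \<open>supp\<close> makes both integrands
  vanish.\<close>

lemma nn_integral_radial_poisson:
  fixes a :: complex
  assumes \<phi> [measurable]: "\<phi> \<in> borel_measurable borel"
    and supp: "\<And>w::complex. norm a * norm w \<ge> 1 \<Longrightarrow> \<phi> ((norm w)\<^sup>2) = (0::ennreal)"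
  shows "(\<integral>\<^sup>+w. \<phi> ((norm w)\<^sup>2) * ennreal (1 / (norm (1 - a * cnj w))\<^sup>2) \<partial>lborel)
       = (\<integral>\<^sup>+(w::complex). \<phi> ((norm w)\<^sup>2) * ennreal (1 / (1 - (norm a)\<^sup>2 * (norm w)\<^sup>2)) \<partial>lborel)"
proof -
  define e :: "real \<Rightarrow> complex" where "e t = exp (2 * of_real pi * \<i> * of_real t)" for t
  have ne: "norm (e t) = 1" for t
    by (simp add: e_def)
  have [measurable]: "e \<in> borel_measurable borel"
    unfolding e_def by (intro borel_measurable_continuous_onI continuous_intros)
  have [measurable]: "cnj \<in> borel_measurable borel"
    by (intro borel_measurable_continuous_onI continuous_intros)
  define G where "G w = \<phi> ((norm w)\<^sup>2) * ennreal (1 / (norm (1 - a * cnj w))\<^sup>2)" for w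
  have [measurable]: "G \<in> borel_measurable borel"
    unfolding G_def by measurable
  have avg: "(\<integral>\<^sup>+t\<in>{0..1}. G (e t * w) \<partial>lborel)
      = \<phi> ((norm w)\<^sup>2) * ennreal (1 / (1 - (norm a)\<^sup>2 * (norm w)\<^sup>2))" for w
  proof (cases "norm a * norm w < 1")
    case True
    have "norm (1 - a * cnj (e t * w)) = norm (1 - cnj a * w * e t)" for t
    proof -
      have "cnj (1 - a * cnj (e t * w)) = 1 - cnj a * w * e t"
        by simp
      then show ?thesis
        by (metis complex_mod_cnj)
    qed
    then have "(\<integral>\<^sup>+t\<in>{0..1}. G (e t * w) \<partial>lborel)
        = (\<integral>\<^sup>+t. \<phi> ((norm w)\<^sup>2) * (ennreal (1 / (norm (1 - cnj a * w * e t))\<^sup>2) * indicator {0..1} t) \<partial>lborel)"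
      by (simp add: G_def norm_mult ne mult.assoc)
    also have "\<dots> = \<phi> ((norm w)\<^sup>2) * (\<integral>\<^sup>+t\<in>{0..1}. ennreal (1 / (norm (1 - cnj a * w * e t))\<^sup>2) \<partial>lborel)"
      by (rule nn_integral_cmult) measurable
    also have "(\<integral>\<^sup>+t\<in>{0..1}. ennreal (1 / (norm (1 - cnj a * w * e t))\<^sup>2) \<partial>lborel)
        = ennreal (1 / (1 - (norm (cnj a * w))\<^sup>2))"
      unfolding e_def by (rule nn_integral_poisson) (use True in \<open>simp add: norm_mult\<close>)
    finally show ?thesis
      by (simp add: norm_mult power_mult_distrib)
  qed (simp add: G_def norm_mult ne supp)
  \<comment> \<open>The unit interval has measure one, so averaging a constant over it changes
    nothing.\<close>
  have "(\<integral>\<^sup>+w. G w \<partial>lborel) = (\<integral>\<^sup>+t\<in>{0..1::real}. (\<integral>\<^sup>+w. G w \<partial>lborel) \<partial>lborel)"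
    by (simp add: nn_integral_cmult)
  also have "\<dots> = (\<integral>\<^sup>+t\<in>{0..1}. (\<integral>\<^sup>+w. G (e t * w) \<partial>lborel) \<partial>lborel)"
    by (simp add: nn_integral_complex_rotate ne)
  also have "\<dots> = (\<integral>\<^sup>+t. (\<integral>\<^sup>+w. G (e t * w) * indicator {0..1} t \<partial>lborel) \<partial>lborel)"
    by (simp add: nn_integral_multc)
  also have "\<dots> = (\<integral>\<^sup>+w. (\<integral>\<^sup>+t\<in>{0..1}. G (e t * w) \<partial>lborel) \<partial>lborel)"
    by (rule lborel_pair.Fubini') measurable
  finally show ?thesis
    by (simp only: avg) (simp only: G_def)
qed

text \<open>The disc of squared radius \<open>a\<close> has area \<open>pi * a\<close>, so the image
  of Lebesgue measure under the squared norm is \<open>pi\<close> times Lebesgue measure on the half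
  line. Half lines generate the Borel sets, so comparing the two measures on them suffices. Using
  the squared norm as variable leaves no Jacobian factor.\<close>

lemma nn_integral_radial:
  assumes [measurable]: "\<psi> \<in> borel_measurable borel"
  shows "(\<integral>\<^sup>+(w::complex). \<psi> ((norm w)\<^sup>2) \<partial>lborel) = ennreal pi * (\<integral>\<^sup>+u\<in>{0..}. \<psi> u \<partial>lborel)"
proof -
  define \<mu> where "\<mu> = distr lborel borel (\<lambda>w::complex. (norm w)\<^sup>2)"
  define \<nu> where "\<nu> = density lborel (\<lambda>u::real. ennreal pi * indicator {0..} u)"
  have 1: "emeasure \<mu> {..a} = ennreal (pi * max 0 a)" for a
  proof -
    have "(norm w)\<^sup>2 \<le> a \<longleftrightarrow> norm w \<le> sqrt a" for w :: complex
      using real_sqrt_le_iff[of "(norm w)\<^sup>2" a] by simp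
    then have "(\<lambda>w::complex. (norm w)\<^sup>2) -` {..a} = cball 0 (sqrt a)"
      by auto
    \<comment> \<open>The root of a negative number is negative by convention, so the ball is empty,
      in agreement with \<open>max 0 a\<close>.\<close>
    moreover have "sqrt a < 0" if "a < 0"
      using that by simp
    ultimately have "emeasure \<mu> {..a} = emeasure lborel (cball (0::complex) (sqrt a))"
      by (simp add: \<mu>_def emeasure_distr)
    also have "\<dots> = ennreal (pi * max 0 a)"
    proof (cases "a < 0")
      case False
      then show ?thesis
        by (simp add: emeasure_cball unit_ball_vol_2 ennreal_mult' max_def)
    qed simp
    finally show ?thesis .
  qed
  have 2: "emeasure \<nu> {..a} = ennreal (pi * max 0 a)" for a
  proof -
    have "emeasure \<nu> {..a} = ennreal pi * (\<integral>\<^sup>+(u::real). indicator {0..} u * indicator {..a} u \<partial>lborel)"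
      unfolding \<nu>_def by (subst emeasure_density) (auto simp: nn_integral_cmult mult.assoc)
    also have "(\<integral>\<^sup>+(u::real). indicator {0..} u * indicator {..a} u \<partial>lborel) = (\<integral>\<^sup>+u. indicator {0..a} u \<partial>lborel)"
      by (intro nn_integral_cong) (auto split: split_indicator)
    finally show ?thesis
      by (cases "a < 0") (simp_all add: max_def ennreal_mult')
  qed
  have "\<mu> = \<nu>"
  proof (rule measure_eqI_generator_eq[where E="range atMost" and \<Omega>=UNIV and A="\<lambda>i. {..real i}"])
    show "Int_stable (range (atMost :: real \<Rightarrow> _))"
      by (auto simp: Int_stable_def)
    show "sets \<mu> = sigma_sets UNIV (range atMost)" "sets \<nu> = sigma_sets UNIV (range atMost)"
      by (simp_all add: \<mu>_def \<nu>_def borel_eq_atMost)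
    show "(\<Union>i. {..real i}) = UNIV"
      by (auto simp: real_arch_simple)
  qed (auto simp: 1 2)
  then have "(\<integral>\<^sup>+u. \<psi> u \<partial>\<mu>) = (\<integral>\<^sup>+u. \<psi> u \<partial>\<nu>)"
    by simp
  then show ?thesis
    by (simp add: \<mu>_def \<nu>_def nn_integral_distr nn_integral_density nn_integral_cmult mult_ac)
qed

section \<open>Forelli-Rudin estimates\<close>

lemma nn_integral_powr_from_0:
  fixes c :: real
  assumes "c > -1" "d \<ge> 0"
  shows "(\<integral>\<^sup>+x\<in>{0..d}. ennreal (x powr c) \<partial>lborel) = ennreal (d powr (c + 1) / (c + 1))"
  using nn_integral_has_integral_lebesgue'[OF _ has_integral_powr_from_0[OF assms]] by simp

text \<open>The maximum is resolved by splitting at \<open>v = d\<close>: below, the integrand is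
  \<open>v powr (-b) / d\<close>, integrable since \<open>b < 1\<close>; above, it is
  \<open>v powr (-b - 1)\<close>, whose integral is controlled by the lower end since
  \<open>b > 0\<close>. Both pieces are of order \<open>d powr (-b)\<close>.\<close>

lemma nn_integral_powr_div_max:
  fixes b d :: real
  assumes b: "0 < b" "b < 1" and d: "0 < d" "d \<le> 1"
  shows "(\<integral>\<^sup>+v\<in>{0..1}. ennreal (v powr (-b) / max d v) \<partial>lborel)
          \<le> ennreal ((1 / (1 - b) + 1 / b) * d powr (-b))"
proof -
  have "(\<integral>\<^sup>+v\<in>{0..1}. ennreal (v powr (-b) / max d v) \<partial>lborel)
      \<le> (\<integral>\<^sup>+v. ennreal (1 / d) * (ennreal (v powr (-b)) * indicator {0..d} v)
            + ennreal (v powr (-b - 1)) * indicator {d..1} v \<partial>lborel)"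
  proof (rule nn_integral_mono)
    fix v :: real
    show "ennreal (v powr (-b) / max d v) * indicator {0..1} v
       \<le> ennreal (1 / d) * (ennreal (v powr (-b)) * indicator {0..d} v)
            + ennreal (v powr (-b - 1)) * indicator {d..1} v"
      using d by (auto split: split_indicator simp: max_def powr_diff ennreal_mult'[symmetric])
  qed
  also have "\<dots> = ennreal (1 / d) * (\<integral>\<^sup>+v\<in>{0..d}. ennreal (v powr (-b)) \<partial>lborel)
      + (\<integral>\<^sup>+v\<in>{d..1}. ennreal (v powr (-b - 1)) \<partial>lborel)"
    by (subst nn_integral_add) (auto simp: nn_integral_cmult)
  also have "(\<integral>\<^sup>+v\<in>{0..d}. ennreal (v powr (-b)) \<partial>lborel) = ennreal (d powr (1 - b) / (1 - b))"
    using nn_integral_powr_from_0[of "-b" d] b d by simp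
  also have "(\<integral>\<^sup>+v\<in>{d..1}. ennreal (v powr (-b - 1)) \<partial>lborel)
      = ennreal (1 powr (-b) / (-b) - d powr (-b) / (-b))"
  proof (rule nn_integral_has_integral_lebesgue')
    show "((\<lambda>v. v powr (-b - 1)) has_integral (1 powr (-b) / (-b) - d powr (-b) / (-b))) {d..1}"
      using d b
      by (intro fundamental_theorem_of_calculus)
         (auto intro!: derivative_eq_intros simp flip: has_real_derivative_iff_has_vector_derivative)
  qed simp
  also have "ennreal (1 / d) * ennreal (d powr (1 - b) / (1 - b)) + ennreal (1 powr (-b) / (-b) - d powr (-b) / (-b))
     = ennreal (d powr (-b) / (1 - b) + (d powr (-b) - 1) / b)"
  proof -
    have "d powr (1 - b) = d * d powr (-b)"
      using d by (simp add: powr_diff powr_minus field_simps)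
    then have "ennreal (1 / d) * ennreal (d powr (1 - b) / (1 - b)) = ennreal (d powr (-b) / (1 - b))"
      using b d by (simp add: ennreal_mult'[symmetric])
    moreover have "1 powr (-b) / (-b) - d powr (-b) / (-b) = (d powr (-b) - 1) / b"
      by (simp add: diff_divide_distrib)
    moreover have "0 \<le> (d powr (-b) - 1) / b"
      using d b by (intro divide_nonneg_pos) (auto simp: powr_minus powr_le1 one_le_inverse_iff)
    ultimately show ?thesis
      using b by (simp only: ennreal_plus[symmetric] divide_nonneg_nonneg powr_ge_zero diff_ge_0_iff_ge less_imp_le)
  qed
  also have "\<dots> \<le> ennreal ((1 / (1 - b) + 1 / b) * d powr (-b))"
    using b by (intro ennreal_leI) (simp add: distrib_right diff_divide_distrib)
  finally show ?thesis .
qed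

text \<open>The singularities at \<open>0\<close> and \<open>1\<close> are separated at
  \<open>1/2\<close>. On the left only \<open>x powr c\<close> matters. On the right
  \<open>x powr c\<close> is bounded and \<open>1 - \<rho> * x\<close> is at least
  \<open>max (1 - \<rho>) (1 - x)\<close>, so after \<open>v = 1 - x\<close> the bound
  \<open>nn_integral_powr_div_max\<close> applies.\<close>

lemma nn_integral_forelli_rudin:
  fixes b c :: real
  assumes b: "0 < b" "b < 1" and c: "c > -1"
  obtains C where "C > 0"
    "\<And>\<rho>. 0 \<le> \<rho> \<Longrightarrow> \<rho> < 1 \<Longrightarrow> (\<integral>\<^sup>+x\<in>{0..1}. ennreal (x powr c * (1 - x) powr (-b) / (1 - \<rho> * x)) \<partial>lborel)
        \<le> ennreal (C * (1 - \<rho>) powr (-b))"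
proof -
  \<comment> \<open>A bound for \<open>x powr c\<close> on the right half that serves both signs of
    \<open>c\<close>: the summand \<open>1\<close> covers \<open>c \<ge> 0\<close>, the other one
    \<open>c < 0\<close>.\<close>
  define M where "M = 1 + (1/2) powr c"
  have M: "M \<ge> 1" by (simp add: M_def)
  have xM: "x powr c \<le> M" if "1/2 \<le> x" "x \<le> 1" for x :: real
  proof (cases "c \<ge> 0")
    case True
    then have "x powr c \<le> 1" using that by (intro powr_le1) auto
    then show ?thesis by (simp add: M_def add_increasing2)
  next
    case False
    then have "x powr c \<le> (1/2) powr c"
      using that by (intro powr_mono2') auto
    then show ?thesis by (simp add: M_def)
  qed
  define C where "C = 4 / (c + 1) + M * (1 / (1 - b) + 1 / b)"
  show ?thesis
  proof (rule that)
    show "C > 0" using b c M by (simp add: C_def add_pos_pos)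
    fix \<rho> :: real
    assume \<rho>: "0 \<le> \<rho>" "\<rho> < 1"
    let ?d = "1 - \<rho>"
    have rx: "\<rho> * x \<le> \<rho>" "\<rho> * x \<le> x" if "0 \<le> x" "x \<le> 1" for x
      using that \<rho> by (auto intro: mult_left_le mult_left_le_one_le)
    \<comment> \<open>The constant \<open>4\<close> is the product of two bounds by \<open>2\<close>
      valid for \<open>x \<le> 1/2\<close>, one for \<open>(1 - x) powr (-b)\<close> and one for
      \<open>1 / (1 - \<rho> * x)\<close>.\<close>
    have pt: "x powr c * (1 - x) powr (-b) / (1 - \<rho> * x)
        \<le> 4 * x powr c + M * ((1 - x) powr (-b) / max ?d (1 - x))" if x: "0 \<le> x" "x \<le> 1" for x
    proof (cases "x \<le> 1/2")
      case True
      have "(1 - x) powr (-b) \<le> (1/2) powr (-b)"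
        using True b by (intro powr_mono2') auto
      also have "\<dots> \<le> 2"
        using b powr_mono[of b 1 2] by (simp add: powr_minus powr_divide)
      finally have 1: "(1 - x) powr (-b) \<le> 2" .
      have "(1 - x) powr (-b) / (1 - \<rho> * x) \<le> 2 / (1/2)"
        using True rx[OF x] by (intro frac_le 1) auto
      then have "x powr c * ((1 - x) powr (-b) / (1 - \<rho> * x)) \<le> x powr c * 4"
        by (intro mult_left_mono) auto
      moreover have "0 \<le> M * ((1 - x) powr (-b) / max ?d (1 - x))"
        using M \<rho> by (auto intro!: mult_nonneg_nonneg divide_nonneg_nonneg)
      ultimately show ?thesis by simp
    next
      case False
      have "x powr c * (1 - x) powr (-b) / (1 - \<rho> * x) \<le> M * (1 - x) powr (-b) / max ?d (1 - x)"
        using False x rx[OF x] \<rho> M by (intro frac_le mult_right_mono xM) (auto simp: max_def)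
      then show ?thesis using False
        by (simp add: add_increasing)
    qed
    have "(\<integral>\<^sup>+x\<in>{0..1}. ennreal (x powr c * (1 - x) powr (-b) / (1 - \<rho> * x)) \<partial>lborel)
       \<le> (\<integral>\<^sup>+x. ennreal 4 * (ennreal (x powr c) * indicator {0..1} x)
             + ennreal M * (ennreal ((1 - x) powr (-b) / max ?d (1 - x)) * indicator {0..1} x) \<partial>lborel)"
    proof (rule nn_integral_mono)
      fix x :: real
      show "ennreal (x powr c * (1 - x) powr (-b) / (1 - \<rho> * x)) * indicator {0..1} x
        \<le> ennreal 4 * (ennreal (x powr c) * indicator {0..1} x)
             + ennreal M * (ennreal ((1 - x) powr (-b) / max ?d (1 - x)) * indicator {0..1} x)"
      proof (cases "x \<in> {0..1}")
        case True
        then have "0 \<le> (1 - x) powr (-b) / max ?d (1 - x)"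
          by (auto intro!: divide_nonneg_nonneg simp: max_def)
        with True pt[of x] M show ?thesis
          by (auto simp: ennreal_mult'[symmetric] ennreal_plus[symmetric] simp del: ennreal_plus ennreal_numeral intro!: ennreal_leI)
      qed simp
    qed
    also have "\<dots> = ennreal 4 * (\<integral>\<^sup>+x\<in>{0..1}. ennreal (x powr c) \<partial>lborel)
        + ennreal M * (\<integral>\<^sup>+x\<in>{0..1}. ennreal ((1 - x) powr (-b) / max ?d (1 - x)) \<partial>lborel)"
      by (subst nn_integral_add) (auto simp: nn_integral_cmult)
    also have "(\<integral>\<^sup>+x\<in>{0..1}. ennreal (x powr c) \<partial>lborel) = ennreal (1 / (c + 1))"
      using nn_integral_powr_from_0[OF c, of 1] by simp
    also have "(\<integral>\<^sup>+x\<in>{0..1}. ennreal ((1 - x) powr (-b) / max ?d (1 - x)) \<partial>lborel)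
        = (\<integral>\<^sup>+v\<in>{0..1}. ennreal (v powr (-b) / max ?d v) \<partial>lborel)"
      by (subst nn_integral_real_affine[where c="-1" and t=1])
         (auto intro!: nn_integral_cong split: split_indicator)
    also have "ennreal 4 * ennreal (1 / (c + 1)) + ennreal M * \<dots>
        \<le> ennreal 4 * ennreal (1 / (c + 1)) + ennreal M * ennreal ((1 / (1 - b) + 1 / b) * ?d powr (-b))"
      using b \<rho> by (intro add_left_mono mult_left_mono nn_integral_powr_div_max) auto
    also have "\<dots> = ennreal (4 / (c + 1) + M * (1 / (1 - b) + 1 / b) * ?d powr (-b))"
      using b c M by (simp add: ennreal_mult'[symmetric] ennreal_plus[symmetric] mult.assoc del: ennreal_plus ennreal_numeral)
    also have "\<dots> \<le> ennreal (C * ?d powr (-b))"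
    proof (rule ennreal_leI)
      \<comment> \<open>This lets the contribution of the left half, which does not grow with
        \<open>\<rho>\<close>, be absorbed into the main term.\<close>
      have "1 \<le> ?d powr (-b)"
        using \<rho> b by (simp add: powr_minus powr_le1 one_le_inverse_iff)
      then have "4 / (c + 1) * 1 \<le> 4 / (c + 1) * ?d powr (-b)"
        using c by (intro mult_left_mono) auto
      then show "4 / (c + 1) + M * (1 / (1 - b) + 1 / b) * ?d powr (-b) \<le> C * ?d powr (-b)"
        by (simp add: C_def algebra_simps)
    qed
    finally show "(\<integral>\<^sup>+x\<in>{0..1}. ennreal (x powr c * (1 - x) powr (-b) / (1 - \<rho> * x)) \<partial>lborel)
        \<le> ennreal (C * ?d powr (-b))" .
  qed
qed

text \<open>Averaging over rotations, passing to \<open>u = (norm w)\<^sup>2\<close> and scaling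
  \<open>u = r\<^sup>2 * x\<close> reduce this to the one-dimensional estimate with
  \<open>\<rho> = (norm a)\<^sup>2 * r\<^sup>2\<close>. The constant depends on neither
  \<open>a\<close> nor \<open>r\<close>, because the radius will itself be a variable of
  integration.\<close>

lemma disc_forelli_rudin:
  fixes b c :: real
  assumes b: "0 < b" "b < 1" and c: "c > -1"
  obtains C where "C > 0"
    "\<And>(a::complex) r. 0 < r \<Longrightarrow> norm a * r < 1 \<Longrightarrow>
      (\<integral>\<^sup>+w\<in>ball 0 r. ennreal (((norm w)\<^sup>2 / r\<^sup>2) powr c * (1 - (norm w)\<^sup>2 / r\<^sup>2) powr (-b) / (norm (1 - a * cnj w))\<^sup>2) \<partial>lborel)
        \<le> ennreal (C * r\<^sup>2 * (1 - (norm a)\<^sup>2 * r\<^sup>2) powr (-b))"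
proof -
  obtain C where C: "C > 0"
    "\<And>\<rho>. 0 \<le> \<rho> \<Longrightarrow> \<rho> < 1 \<Longrightarrow> (\<integral>\<^sup>+x\<in>{0..1}. ennreal (x powr c * (1 - x) powr (-b) / (1 - \<rho> * x)) \<partial>lborel)
        \<le> ennreal (C * (1 - \<rho>) powr (-b))"
    by (rule nn_integral_forelli_rudin[OF assms]) (rule that)
  show ?thesis
  proof (rule that)
    show "pi * C > 0" using C by simp
    fix a :: complex and r :: real
    assume r: "0 < r" and ar: "norm a * r < 1"
    \<comment> \<open>The indicator of the disc is built into the radial factor; since
      \<open>norm a * r < 1\<close>, it supplies the support condition of
      \<open>nn_integral_radial_poisson\<close>.\<close>
    define \<phi> where "\<phi> u = ennreal ((u / r\<^sup>2) powr c * (1 - u / r\<^sup>2) powr (-b)) * indicator {..<r\<^sup>2} u" for u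
    define \<rho> where "\<rho> = (norm a)\<^sup>2 * r\<^sup>2"
    have \<rho>: "0 \<le> \<rho>" "\<rho> < 1"
      using ar r by (auto simp: \<rho>_def power_mult_distrib[symmetric] abs_square_less_1)
    have [measurable]: "\<phi> \<in> borel_measurable borel"
      unfolding \<phi>_def by measurable
    have ind: "indicator {..<r\<^sup>2} ((norm w)\<^sup>2) = (indicator (ball 0 r) w :: ennreal)" for w :: complex
      using r by (simp add: indicator_def power_mono_iff flip: not_le)
    have "(\<integral>\<^sup>+w\<in>ball 0 r. ennreal (((norm w)\<^sup>2 / r\<^sup>2) powr c * (1 - (norm w)\<^sup>2 / r\<^sup>2) powr (-b) / (norm (1 - a * cnj w))\<^sup>2) \<partial>lborel)
      = (\<integral>\<^sup>+w. \<phi> ((norm w)\<^sup>2) * ennreal (1 / (norm (1 - a * cnj w))\<^sup>2) \<partial>lborel)"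
      by (intro nn_integral_cong) (auto simp: \<phi>_def ind ennreal_mult'[symmetric] split: split_indicator)
    also have "\<dots> = (\<integral>\<^sup>+(w::complex). \<phi> ((norm w)\<^sup>2) * ennreal (1 / (1 - (norm a)\<^sup>2 * (norm w)\<^sup>2)) \<partial>lborel)"
    proof (rule nn_integral_radial_poisson)
      fix w :: complex
      assume aw: "norm a * norm w \<ge> 1"
      have "\<not> norm w < r"
      proof
        assume "norm w < r"
        then have "norm a * norm w \<le> norm a * r" by (intro mult_left_mono) auto
        with aw ar show False by simp
      qed
      then show "\<phi> ((norm w)\<^sup>2) = 0" by (simp add: \<phi>_def ind)
    qed measurable
    also have "\<dots> = ennreal pi * (\<integral>\<^sup>+u\<in>{0..}. (\<phi> u * ennreal (1 / (1 - (norm a)\<^sup>2 * u))) \<partial>lborel)"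
      by (rule nn_integral_radial) measurable
    also have "(\<integral>\<^sup>+u\<in>{0..}. (\<phi> u * ennreal (1 / (1 - (norm a)\<^sup>2 * u))) \<partial>lborel)
       = ennreal (r\<^sup>2) * (\<integral>\<^sup>+x. \<phi> (r\<^sup>2 * x) * ennreal (1 / (1 - (norm a)\<^sup>2 * (r\<^sup>2 * x))) * indicator {0..} (r\<^sup>2 * x) \<partial>lborel)"
      using r by (subst nn_integral_real_affine[where c="r\<^sup>2" and t=0]) auto
    also have "ennreal pi * \<dots> \<le> ennreal pi * (ennreal (r\<^sup>2) * ennreal (C * (1 - \<rho>) powr (-b)))"
    proof (intro mult_left_mono)
      have "(\<integral>\<^sup>+x. \<phi> (r\<^sup>2 * x) * ennreal (1 / (1 - (norm a)\<^sup>2 * (r\<^sup>2 * x))) * indicator {0..} (r\<^sup>2 * x) \<partial>lborel)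
         \<le> (\<integral>\<^sup>+x\<in>{0..1}. ennreal (x powr c * (1 - x) powr (-b) / (1 - \<rho> * x)) \<partial>lborel)"
      proof (rule nn_integral_mono)
        fix x :: real
        show "\<phi> (r\<^sup>2 * x) * ennreal (1 / (1 - (norm a)\<^sup>2 * (r\<^sup>2 * x))) * indicator {0..} (r\<^sup>2 * x)
          \<le> ennreal (x powr c * (1 - x) powr (-b) / (1 - \<rho> * x)) * indicator {0..1} x"
          using r by (auto simp: \<phi>_def \<rho>_def ennreal_mult'[symmetric] zero_le_mult_iff mult.assoc split: split_indicator)
      qed
      also have "\<dots> \<le> ennreal (C * (1 - \<rho>) powr (-b))"
        by (intro C(2) \<rho>)
      finally show "(\<integral>\<^sup>+x. \<phi> (r\<^sup>2 * x) * ennreal (1 / (1 - (norm a)\<^sup>2 * (r\<^sup>2 * x))) * indicator {0..} (r\<^sup>2 * x) \<partial>lborel)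
         \<le> ennreal (C * (1 - \<rho>) powr (-b))" .
    qed auto
    also have "\<dots> = ennreal (pi * C * r\<^sup>2 * (1 - (norm a)\<^sup>2 * r\<^sup>2) powr (-b))"
      using C by (simp add: ennreal_mult'[symmetric] \<rho>_def mult_ac)
    finally show "(\<integral>\<^sup>+w\<in>ball 0 r. ennreal (((norm w)\<^sup>2 / r\<^sup>2) powr c * (1 - (norm w)\<^sup>2 / r\<^sup>2) powr (-b) / (norm (1 - a * cnj w))\<^sup>2) \<partial>lborel)
        \<le> ennreal (pi * C * r\<^sup>2 * (1 - (norm a)\<^sup>2 * r\<^sup>2) powr (-b))" .
  qed
qed

section \<open>Schur test of weak type\<close>

text \<open>Young's inequality for \<open>(x / m) powr p\<close> and \<open>1\<close>. Equivalently,
  the convex function \<open>x powr p\<close> lies above its tangent at \<open>m\<close>; equality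
  holds at \<open>x = m\<close>.\<close>

lemma powr_tangent_ge:
  fixes x m p :: real
  assumes "p > 1" "x \<ge> 0" "m > 0"
  shows "x \<le> m powr (1 - p) * x powr p / p + (1 - 1 / p) * m"
proof (cases "x = 0")
  case False
  have "(x powr p / m powr p) powr (1/p) * 1 powr (1 - 1/p) \<le> (1/p) * (x powr p / m powr p) + (1 - 1/p) * 1"
    using assms False by (intro Youngs_inequality_0) auto
  also have "(x powr p / m powr p) powr (1/p) = x / m"
    using assms by (simp add: powr_divide powr_powr)
  finally have "x / m * m \<le> ((1/p) * (x powr p / m powr p) + (1 - 1/p)) * m"
    using assms by (intro mult_right_mono) auto
  also have "\<dots> = m powr (1 - p) * x powr p / p + (1 - 1 / p) * m"
    using assms by (simp add: powr_diff field_simps)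
  finally show ?thesis
    using assms by simp
qed (use assms in simp)

text \<open>In place of Hoelder's inequality, the tangent line inequality is integrated with
  \<open>x = f w / h w\<close> and \<open>m = lam / a\<close>; this choice of \<open>m\<close> absorbs the term with \<open>h\<close> into \<open>lam\<close>.\<close>

lemma schur_test_pointwise:
  fixes L h f :: "'a \<Rightarrow> real" and p lam a :: real
  assumes p: "p > 1" and lam: "lam > 0" and a: "a > 0"
    and [measurable]: "L \<in> borel_measurable M" "h \<in> borel_measurable M" "f \<in> borel_measurable M" "H \<in> sets M"
    and L: "\<And>w. w \<in> H \<Longrightarrow> L w \<ge> 0" and h: "\<And>w. w \<in> H \<Longrightarrow> h w > 0" and f: "\<And>w. w \<in> H \<Longrightarrow> f w \<ge> 0"
    and Lh: "(\<integral>\<^sup>+w\<in>H. ennreal (L w * h w) \<partial>M) \<le> ennreal a"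
    and big: "(\<integral>\<^sup>+w\<in>H. ennreal (L w * f w) \<partial>M) > ennreal lam"
  shows "ennreal (lam powr p) \<le> ennreal (a powr (p - 1)) * (\<integral>\<^sup>+w\<in>H. ennreal (L w * f w powr p * h w powr (1 - p)) \<partial>M)"
proof (cases "(\<integral>\<^sup>+w\<in>H. ennreal (L w * f w powr p * h w powr (1 - p)) \<partial>M)")
  case top
  then show ?thesis using a by (simp add: ennreal_mult_top)
next
  case (real S)
  define m where "m = lam / a"
  have m: "m > 0" using lam a by (simp add: m_def)
  have c2: "0 \<le> (1 - 1 / p) * m"
    using p m by simp
  have "ennreal lam \<le> (\<integral>\<^sup>+w\<in>H. ennreal (L w * f w) \<partial>M)"
    using big by simp
  also have "\<dots> \<le> (\<integral>\<^sup>+w. ennreal (m powr (1 - p) / p) * (ennreal (L w * f w powr p * h w powr (1 - p)) * indicator H w)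
      + ennreal ((1 - 1 / p) * m) * (ennreal (L w * h w) * indicator H w) \<partial>M)"
  proof (rule nn_integral_mono)
    fix w
    show "ennreal (L w * f w) * indicator H w
      \<le> ennreal (m powr (1 - p) / p) * (ennreal (L w * f w powr p * h w powr (1 - p)) * indicator H w)
      + ennreal ((1 - 1 / p) * m) * (ennreal (L w * h w) * indicator H w)"
    proof (cases "w \<in> H")
      case True
      note pos = L[OF True] h[OF True] f[OF True]
      have "f w / h w \<le> m powr (1 - p) * (f w / h w) powr p / p + (1 - 1 / p) * m"
        using p m pos by (intro powr_tangent_ge) auto
      then have "(L w * h w) * (f w / h w) \<le> (L w * h w) * (m powr (1 - p) * (f w / h w) powr p / p + (1 - 1 / p) * m)"
        using pos by (intro mult_left_mono) auto
      also have "(L w * h w) * (f w / h w) = L w * f w"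
        using pos by simp
      also have "(L w * h w) * (m powr (1 - p) * (f w / h w) powr p / p + (1 - 1 / p) * m)
        = (m powr (1 - p) / p) * (L w * f w powr p * h w powr (1 - p)) + ((1 - 1 / p) * m) * (L w * h w)"
        using pos p by (simp add: powr_divide powr_diff field_simps)
      finally have "ennreal (L w * f w) \<le> ennreal ((m powr (1 - p) / p) * (L w * f w powr p * h w powr (1 - p)) + ((1 - 1 / p) * m) * (L w * h w))"
        by (rule ennreal_leI)
      also have "\<dots> = ennreal (m powr (1 - p) / p) * ennreal (L w * f w powr p * h w powr (1 - p))
          + ennreal ((1 - 1 / p) * m) * ennreal (L w * h w)"
        using pos p m
        by (subst ennreal_plus, simp, simp)
          (simp only: ennreal_mult'[of "m powr (1 - p) / p" "L w * f w powr p * h w powr (1 - p)"]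
            ennreal_mult'[of "(1 - 1 / p) * m" "L w * h w"] divide_nonneg_nonneg mult_nonneg_nonneg
            powr_ge_zero less_imp_le c2)
      finally show ?thesis
        using True by simp
    qed simp
  qed
  also have "\<dots> = ennreal (m powr (1 - p) / p) * ennreal S + ennreal ((1 - 1 / p) * m) * (\<integral>\<^sup>+w\<in>H. ennreal (L w * h w) \<partial>M)"
    unfolding real(2)[symmetric] by (subst nn_integral_add) (auto simp: nn_integral_cmult)
  also have "\<dots> \<le> ennreal (m powr (1 - p) / p) * ennreal S + ennreal ((1 - 1 / p) * m) * ennreal a"
    by (intro add_left_mono mult_left_mono Lh) auto
  also have "\<dots> = ennreal (m powr (1 - p) / p * S + (1 - 1 / p) * m * a)"
    using p m a real c2 by (subst ennreal_plus, simp, simp)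
      (simp only: ennreal_mult'[of "m powr (1 - p) / p" S] ennreal_mult'[of "(1 - 1 / p) * m" a]
        divide_nonneg_nonneg powr_ge_zero less_imp_le)
  finally have "lam \<le> m powr (1 - p) / p * S + (1 - 1 / p) * m * a"
    using p m a real by (subst (asm) ennreal_le_iff) (auto intro!: mult_nonneg_nonneg add_nonneg_nonneg)
  then have "lam \<le> m powr (1 - p) / p * S + (1 - 1 / p) * lam"
    using a by (simp add: m_def)
  then have "lam \<le> m powr (1 - p) * S"
    using p by (simp add: field_simps)
  \<comment> \<open>Multiplying by \<open>lam powr (p - 1)\<close> produces the power
    \<open>lam powr p\<close> on the left, while on the right \<open>lam\<close> cancels from
    \<open>m powr (1 - p)\<close> and leaves \<open>a powr (p - 1)\<close>.\<close>
  then have "lam * lam powr (p - 1) \<le> m powr (1 - p) * S * lam powr (p - 1)"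
    by (rule mult_right_mono) simp
  also have "lam * lam powr (p - 1) = lam powr p"
    using lam by (simp add: powr_diff)
  also have "m powr (1 - p) * S * lam powr (p - 1) = a powr (p - 1) * S"
    using lam a by (simp add: m_def powr_divide powr_diff field_simps)
  finally show ?thesis
    using real by (simp add: ennreal_mult'[symmetric] ennreal_leI)
qed

text \<open>At every point of the level set the pointwise test bounds \<open>lam powr p\<close> by
  an integral in \<open>w\<close> times a power of \<open>A * k z\<close>. Integrating in
  \<open>z\<close> as in Chebyshev's inequality and exchanging the integrals leaves the second test
  integral. The factor \<open>v\<close> in \<open>Kk\<close> is the weight of the resulting
  norm.\<close>

lemma schur_test_weak_type:
  fixes K :: "'a \<Rightarrow> 'a \<Rightarrow> real" and h k v f :: "'a \<Rightarrow> real" and p lam A B :: real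
  assumes M: "sigma_finite_measure M" and p: "p > 1" and lam: "lam > 0" and A: "A > 0" and B: "B > 0"
    and K_meas [measurable]: "(\<lambda>(z, w). K z w) \<in> borel_measurable (M \<Otimes>\<^sub>M M)"
    and [measurable]: "h \<in> borel_measurable M" "k \<in> borel_measurable M" "v \<in> borel_measurable M"
      "f \<in> borel_measurable M" "H \<in> sets M"
    and K: "\<And>z w. z \<in> H \<Longrightarrow> w \<in> H \<Longrightarrow> K z w \<ge> 0" and h: "\<And>w. w \<in> H \<Longrightarrow> h w > 0"
    and k: "\<And>z. z \<in> H \<Longrightarrow> k z > 0" and f: "\<And>w. w \<in> H \<Longrightarrow> f w \<ge> 0"
    and Kh: "\<And>z. z \<in> H \<Longrightarrow> (\<integral>\<^sup>+w\<in>H. ennreal (K z w * h w) \<partial>M) \<le> ennreal (A * k z)"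
    and Kk: "\<And>w. w \<in> H \<Longrightarrow> (\<integral>\<^sup>+z\<in>H. ennreal (K z w * k z powr (p - 1)) \<partial>M)
                \<le> ennreal (B * h w powr (p - 1) * v w)"
  shows "ennreal (lam powr p) * emeasure M {z \<in> H. (\<integral>\<^sup>+w\<in>H. ennreal (K z w * f w) \<partial>M) > ennreal lam}
      \<le> ennreal (A powr (p - 1) * B) * (\<integral>\<^sup>+w\<in>H. ennreal (f w powr p * v w) \<partial>M)"
proof -
  interpret sigma_finite_measure M by fact
  interpret pair_sigma_finite M M by standard
  have [measurable]: "(\<lambda>w. K z w) \<in> borel_measurable M" if "z \<in> space M" for z
    using measurable_Pair2[OF K_meas that] by simp
  have [measurable]: "(\<lambda>z. K z w) \<in> borel_measurable M" if "w \<in> space M" for w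
    using measurable_Pair1[OF K_meas that] by simp
  have [measurable (raw)]: "(\<lambda>x. K (F x) (G x)) \<in> borel_measurable N"
    if [measurable]: "F \<in> measurable N M" "G \<in> measurable N M" for F G and N :: "'c measure"
  proof -
    have "(\<lambda>x. (\<lambda>(z, w). K z w) (F x, G x)) \<in> borel_measurable N"
      by measurable
    then show ?thesis by simp
  qed
  have Hs: "z \<in> space M" if "z \<in> H" for z
    using that \<open>H \<in> sets M\<close> sets.sets_into_space by blast
  define E where "E = {z \<in> space M. z \<in> H \<and> (\<integral>\<^sup>+w\<in>H. ennreal (K z w * f w) \<partial>M) > ennreal lam}"
  have E_eq: "{z \<in> H. (\<integral>\<^sup>+w\<in>H. ennreal (K z w * f w) \<partial>M) > ennreal lam} = E"
    using Hs by (auto simp: E_def)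
  have [measurable]: "E \<in> sets M"
    unfolding E_def by measurable
  define S where "S z = (\<integral>\<^sup>+w\<in>H. ennreal (K z w * f w powr p * h w powr (1 - p)) \<partial>M)" for z
  have "ennreal (lam powr p) * emeasure M E = (\<integral>\<^sup>+z\<in>E. ennreal (lam powr p) \<partial>M)"
    by (simp add: nn_integral_cmult)
  \<comment> \<open>The pointwise test is applied on \<open>E\<close>; off \<open>E\<close> the left
    side vanishes, so the domain may grow to \<open>H\<close>.\<close>
  also have "\<dots> \<le> (\<integral>\<^sup>+z\<in>H. ennreal ((A * k z) powr (p - 1)) * S z \<partial>M)"
  proof (rule nn_integral_mono)
    fix z
    show "ennreal (lam powr p) * indicator E z \<le> ennreal ((A * k z) powr (p - 1)) * S z * indicator H z"
    proof (cases "z \<in> E")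
      case True
      then have z: "z \<in> H" "z \<in> space M" and big: "(\<integral>\<^sup>+w\<in>H. ennreal (K z w * f w) \<partial>M) > ennreal lam"
        by (auto simp: E_def)
      have "ennreal (lam powr p) \<le> ennreal ((A * k z) powr (p - 1)) * S z"
        unfolding S_def using p lam A k z
        by (intro schur_test_pointwise[OF _ _ _ _ _ _ _ K h f Kh big]) auto
      then show ?thesis using True z by simp
    qed simp
  qed
  also have "\<dots> = (\<integral>\<^sup>+z. \<integral>\<^sup>+w. ennreal (A powr (p - 1)) * (ennreal (f w powr p * h w powr (1 - p)) * indicator H w *
      (ennreal (K z w * k z powr (p - 1)) * indicator H z)) \<partial>M \<partial>M)"
  proof (rule nn_integral_cong)
    fix z assume z: "z \<in> space M"
    show "ennreal ((A * k z) powr (p - 1)) * S z * indicator H z = (\<integral>\<^sup>+w. ennreal (A powr (p - 1)) *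
      (ennreal (f w powr p * h w powr (1 - p)) * indicator H w * (ennreal (K z w * k z powr (p - 1)) * indicator H z)) \<partial>M)"
    proof (cases "z \<in> H")
      case True
      have "ennreal ((A * k z) powr (p - 1)) * S z = (\<integral>\<^sup>+w. ennreal ((A * k z) powr (p - 1)) *
          (ennreal (K z w * f w powr p * h w powr (1 - p)) * indicator H w) \<partial>M)"
        unfolding S_def using z by (intro nn_integral_cmult[symmetric]) measurable
      also have "\<dots> = (\<integral>\<^sup>+w. ennreal (A powr (p - 1)) *
          (ennreal (f w powr p * h w powr (1 - p)) * indicator H w * (ennreal (K z w * k z powr (p - 1)) * indicator H z)) \<partial>M)"
      proof (rule nn_integral_cong)
        fix w
        have "(A * k z) powr (p - 1) * (K z w * f w powr p * h w powr (1 - p))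
            = A powr (p - 1) * (f w powr p * h w powr (1 - p) * (K z w * k z powr (p - 1)))"
          using A k[OF True] by (simp add: powr_mult)
        then have "ennreal ((A * k z) powr (p - 1)) * ennreal (K z w * f w powr p * h w powr (1 - p))
            = ennreal (A powr (p - 1)) * (ennreal (f w powr p * h w powr (1 - p)) * ennreal (K z w * k z powr (p - 1)))"
          by (simp only: ennreal_mult'[symmetric] powr_ge_zero mult_nonneg_nonneg)
        then show "ennreal ((A * k z) powr (p - 1)) *
          (ennreal (K z w * f w powr p * h w powr (1 - p)) * indicator H w) = ennreal (A powr (p - 1)) *
          (ennreal (f w powr p * h w powr (1 - p)) * indicator H w * (ennreal (K z w * k z powr (p - 1)) * indicator H z))"
          using True by (simp split: split_indicator)
      qed
      finally show ?thesis using True by simp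
    qed simp
  qed
  \<comment> \<open>With the factors depending on \<open>w\<close> alone separated, the inner
    integral in \<open>z\<close> is the one bounded by \<open>Kk\<close>.\<close>
  also have "\<dots> = (\<integral>\<^sup>+w. \<integral>\<^sup>+z. ennreal (A powr (p - 1)) * (ennreal (f w powr p * h w powr (1 - p)) * indicator H w *
      (ennreal (K z w * k z powr (p - 1)) * indicator H z)) \<partial>M \<partial>M)"
    by (rule Fubini'[symmetric]) measurable
  also have "\<dots> \<le> (\<integral>\<^sup>+w. ennreal (A powr (p - 1) * B) * (ennreal (f w powr p * v w) * indicator H w) \<partial>M)"
  proof (rule nn_integral_mono)
    fix w assume w: "w \<in> space M"
    show "(\<integral>\<^sup>+z. ennreal (A powr (p - 1)) * (ennreal (f w powr p * h w powr (1 - p)) * indicator H w *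
      (ennreal (K z w * k z powr (p - 1)) * indicator H z)) \<partial>M)
       \<le> ennreal (A powr (p - 1) * B) * (ennreal (f w powr p * v w) * indicator H w)"
    proof (cases "w \<in> H")
      case True
      have "(\<integral>\<^sup>+z. ennreal (A powr (p - 1)) * (ennreal (f w powr p * h w powr (1 - p)) * indicator H w *
          (ennreal (K z w * k z powr (p - 1)) * indicator H z)) \<partial>M)
        = ennreal (A powr (p - 1) * (f w powr p * h w powr (1 - p))) * (\<integral>\<^sup>+z\<in>H. ennreal (K z w * k z powr (p - 1)) \<partial>M)"
        using True w by (subst nn_integral_cmult[symmetric]) (auto simp: ennreal_mult' mult.assoc)
      also have "\<dots> \<le> ennreal (A powr (p - 1) * (f w powr p * h w powr (1 - p))) * ennreal (B * h w powr (p - 1) * v w)"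
        by (intro mult_left_mono Kk True) auto
      also have "\<dots> = ennreal (A powr (p - 1) * (f w powr p * h w powr (1 - p)) * (B * h w powr (p - 1) * v w))"
        by (intro ennreal_mult'[symmetric]) auto
      \<comment> \<open>The power \<open>h w powr (1 - p)\<close> from the pointwise test cancels
        \<open>h w powr (p - 1)\<close> from \<open>Kk\<close>.\<close>
      also have "A powr (p - 1) * (f w powr p * h w powr (1 - p)) * (B * h w powr (p - 1) * v w)
          = A powr (p - 1) * B * (f w powr p * v w)"
        using h[OF True] by (simp add: powr_diff)
      finally show ?thesis
        using True A B by (simp add: ennreal_mult'[symmetric])
    qed simp
  qed
  also have "\<dots> = ennreal (A powr (p - 1) * B) * (\<integral>\<^sup>+w\<in>H. ennreal (f w powr p * v w) \<partial>M)"
    by (rule nn_integral_cmult) measurable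
  finally show ?thesis
    unfolding E_eq .
qed

section \<open>The Hartogs triangle\<close>

text \<open>Both disc factors share the exponent \<open>-b\<close>, so the family is closed under
  real powers and contains both test functions of the Schur test together with the powers needed of
  them.\<close>

definition hartogs_weight :: "real \<Rightarrow> real \<Rightarrow> complex \<times> complex \<Rightarrow> real" where
  "hartogs_weight e b w = norm (snd w) powr e
     * ((1 - (norm (fst w))\<^sup>2 / (norm (snd w))\<^sup>2) powr (-b) * (1 - (norm (snd w))\<^sup>2) powr (-b))"

lemma hartogs_weight_powr: "hartogs_weight e b w powr s = hartogs_weight (e * s) (b * s) w"
  by (simp add: hartogs_weight_def powr_mult powr_powr)

lemma hartogs_weight_pos:
  assumes "w \<in> hartogs"
  shows "hartogs_weight e b w > 0"
proof -
  have w: "norm (fst w) < norm (snd w)" "norm (snd w) < 1"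
    using assms by (auto simp: hartogs_def)
  then have "0 < norm (snd w)"
    by (rule_tac le_less_trans[OF norm_ge_zero])
  moreover have "(norm (fst w))\<^sup>2 < (norm (snd w))\<^sup>2" "(norm (snd w))\<^sup>2 < 1\<^sup>2"
    using w by (intro power_strict_mono; simp)+
  ultimately show ?thesis
    by (auto simp: hartogs_weight_def intro!: mult_pos_pos)
qed

lemma measurable_cnj [measurable]: "cnj \<in> borel_measurable borel"
  by (intro borel_measurable_continuous_onI continuous_intros)

lemma measurable_hartogs_weight [measurable]: "hartogs_weight e b \<in> borel_measurable borel"
  unfolding hartogs_weight_def borel_prod[symmetric] by measurable

lemma sets_hartogs [measurable]: "hartogs \<in> sets borel"
proof -
  have *: "hartogs = {w \<in> space (borel \<Otimes>\<^sub>M borel). norm (fst w) < norm (snd w) \<and> norm (snd w) < 1}"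
    by (auto simp: hartogs_def space_pair_measure)
  show ?thesis
    unfolding borel_prod[symmetric] by (subst *) measurable
qed

lemma measurable_hartogs_kernel:
  "(\<lambda>(z, w). hartogs_kernel z w) \<in> borel_measurable (borel \<Otimes>\<^sub>M borel)"
  unfolding hartogs_kernel_def borel_prod[symmetric] by measurable

text \<open>The kernel is Hermitian. Hence one integral estimate serves both conditions of the Schur
  test.\<close>

lemma norm_hartogs_kernel_commute: "norm (hartogs_kernel z w) = norm (hartogs_kernel w z)"
proof -
  have "hartogs_kernel z w = cnj (hartogs_kernel w z)"
    by (simp add: hartogs_kernel_def mult_ac)
  then show ?thesis by simp
qed

text \<open>For fixed \<open>w2\<close> the integral in \<open>w1\<close> is a disc integral of
  radius \<open>norm w2\<close>; what remains is an integral in \<open>w2\<close> over the unit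
  disc. The two disc estimates return the two boundary factors at \<open>z\<close>, and the factor
  \<open>1 / norm z2\<close> of the kernel gives the exponent \<open>-1\<close>.\<close>

lemma hartogs_forelli_rudin:
  fixes b e :: real
  assumes b: "0 < b" "b < 1" and e: "e > -3"
  obtains C where "C > 0"
    "\<And>z. z \<in> hartogs \<Longrightarrow> (\<integral>\<^sup>+w\<in>hartogs. ennreal (norm (hartogs_kernel z w) * hartogs_weight e b w) \<partial>lborel)
        \<le> ennreal (C * hartogs_weight (-1) b z)"
proof -
  obtain C0 where C0: "C0 > 0"
    "\<And>(a::complex) r. 0 < r \<Longrightarrow> norm a * r < 1 \<Longrightarrow>
      (\<integral>\<^sup>+w\<in>ball 0 r. ennreal (((norm w)\<^sup>2 / r\<^sup>2) powr 0 * (1 - (norm w)\<^sup>2 / r\<^sup>2) powr (-b) / (norm (1 - a * cnj w))\<^sup>2) \<partial>lborel)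
        \<le> ennreal (C0 * r\<^sup>2 * (1 - (norm a)\<^sup>2 * r\<^sup>2) powr (-b))"
    by (rule disc_forelli_rudin[OF b, of 0]) (simp, rule that)
  \<comment> \<open>The weight contributes \<open>e\<close>, the kernel \<open>-1\<close> and the
    area of the \<open>w1\<close> disc \<open>2\<close> to the exponent of \<open>norm w2\<close>;
    halving converts to a power of the squared norm. The condition \<open>c > -1\<close> is exactly
    \<open>e > -3\<close>.\<close>
  define c where "c = (e + 1) / 2"
  obtain C1 where C1: "C1 > 0"
    "\<And>(a::complex) r. 0 < r \<Longrightarrow> norm a * r < 1 \<Longrightarrow>
      (\<integral>\<^sup>+w\<in>ball 0 r. ennreal (((norm w)\<^sup>2 / r\<^sup>2) powr c * (1 - (norm w)\<^sup>2 / r\<^sup>2) powr (-b) / (norm (1 - a * cnj w))\<^sup>2) \<partial>lborel)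
        \<le> ennreal (C1 * r\<^sup>2 * (1 - (norm a)\<^sup>2 * r\<^sup>2) powr (-b))"
    by (rule disc_forelli_rudin[OF b, of c]) (use e in \<open>simp add: c_def\<close>, rule that)
  show ?thesis
  proof (rule that)
    show "C0 * C1 / pi\<^sup>2 > 0" using C0 C1 by simp
    fix z assume "z \<in> hartogs"
    then obtain z1 z2 where z: "z = (z1, z2)" "norm z1 < norm z2" "norm z2 < 1"
      by (cases z) (auto simp: hartogs_def)
    then have z2: "z2 \<noteq> 0" by auto
    define q where "q = (1 - (norm z1)\<^sup>2 / (norm z2)\<^sup>2) powr (-b)"
    define F where "F w = ennreal (norm (hartogs_kernel z w) * hartogs_weight e b w) * indicator hartogs w" for w
    have [measurable]: "(\<lambda>w. hartogs_kernel z w) \<in> borel_measurable borel"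
      using measurable_Pair2[OF measurable_hartogs_kernel, of z] by simp
    have F [measurable]: "F \<in> borel_measurable borel"
      unfolding F_def by measurable
    have [measurable]: "ball 0 1 \<in> sets (borel :: complex measure)"
      by simp
    have inner: "(\<integral>\<^sup>+w1. F (w1, w2) \<partial>lborel) \<le> ennreal (C0 * q / (pi\<^sup>2 * norm z2)) *
        (ennreal (((norm w2)\<^sup>2 / 1\<^sup>2) powr c * (1 - (norm w2)\<^sup>2 / 1\<^sup>2) powr (-b) / (norm (1 - z2 * cnj w2))\<^sup>2) * indicator (ball 0 1) w2)"
      if "w2 \<noteq> 0" for w2
    proof (cases "norm w2 < 1")
      case False
      then have "F (w1, w2) = 0" for w1
        by (simp add: F_def hartogs_def)
      then show ?thesis by simp
    next
      case True
      \<comment> \<open>This turns the first kernel factor into \<open>1 - a * cnj w1\<close>. The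
        product \<open>norm a * norm w2\<close> does not depend on \<open>w2\<close>, so the
        resulting factor \<open>q\<close> leaves the outer integral.\<close>
      define a where "a = z1 / (z2 * cnj w2)"
      define \<alpha> where "\<alpha> = norm w2 powr e * (1 - (norm w2)\<^sup>2) powr (-b) / (pi\<^sup>2 * norm z2 * norm w2 * (norm (1 - z2 * cnj w2))\<^sup>2)"
      have \<alpha>: "\<alpha> \<ge> 0" by (simp add: \<alpha>_def)
      have na: "norm a * norm w2 = norm z1 / norm z2"
        using that by (simp add: a_def norm_divide norm_mult)
      have [measurable]: "ball 0 (norm w2) \<in> sets (borel :: complex measure)"
        by simp
      have [measurable]: "(\<lambda>w1. ennreal ((1 - (norm w1)\<^sup>2 / (norm w2)\<^sup>2) powr (-b) / (norm (1 - a * cnj w1))\<^sup>2)) \<in> borel_measurable borel"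
        by measurable
      have "(\<integral>\<^sup>+w1. F (w1, w2) \<partial>lborel) = (\<integral>\<^sup>+w1. ennreal \<alpha> *
          (ennreal ((1 - (norm w1)\<^sup>2 / (norm w2)\<^sup>2) powr (-b) / (norm (1 - a * cnj w1))\<^sup>2) * indicator (ball 0 (norm w2)) w1) \<partial>lborel)"
      proof (rule nn_integral_cong)
        fix w1
        have "norm (hartogs_kernel z (w1, w2)) * hartogs_weight e b (w1, w2)
            = \<alpha> * ((1 - (norm w1)\<^sup>2 / (norm w2)\<^sup>2) powr (-b) / (norm (1 - a * cnj w1))\<^sup>2)"
          by (simp add: hartogs_kernel_def hartogs_weight_def \<alpha>_def a_def z norm_divide norm_mult norm_power mult_ac)
        then show "F (w1, w2) = ennreal \<alpha> *
          (ennreal ((1 - (norm w1)\<^sup>2 / (norm w2)\<^sup>2) powr (-b) / (norm (1 - a * cnj w1))\<^sup>2) * indicator (ball 0 (norm w2)) w1)"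
          using True
          by (simp add: F_def hartogs_def ennreal_mult'[OF \<alpha>] del: times_divide_eq_right split: split_indicator)
      qed
      also have "\<dots> = ennreal \<alpha> * (\<integral>\<^sup>+w1\<in>ball 0 (norm w2).
          ennreal ((1 - (norm w1)\<^sup>2 / (norm w2)\<^sup>2) powr (-b) / (norm (1 - a * cnj w1))\<^sup>2) \<partial>lborel)"
        by (rule nn_integral_cmult) measurable
      \<comment> \<open>As \<open>0 powr 0\<close> is \<open>0\<close>, the inserted power is
        \<open>1\<close> only away from the origin, so the equality of integrands holds almost
        everywhere.\<close>
      also have "(\<integral>\<^sup>+w1\<in>ball 0 (norm w2).
          ennreal ((1 - (norm w1)\<^sup>2 / (norm w2)\<^sup>2) powr (-b) / (norm (1 - a * cnj w1))\<^sup>2) \<partial>lborel)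
          = (\<integral>\<^sup>+w1\<in>ball 0 (norm w2).
          ennreal (((norm w1)\<^sup>2 / (norm w2)\<^sup>2) powr 0 * (1 - (norm w1)\<^sup>2 / (norm w2)\<^sup>2) powr (-b) / (norm (1 - a * cnj w1))\<^sup>2) \<partial>lborel)"
        using AE_lborel_singleton[of "0::complex"] that
        by (intro nn_integral_cong_AE) (auto elim: eventually_mono)
      also have "ennreal \<alpha> * \<dots> \<le> ennreal \<alpha> * ennreal (C0 * (norm w2)\<^sup>2 * (1 - (norm a)\<^sup>2 * (norm w2)\<^sup>2) powr (-b))"
        using that z2 z by (intro mult_left_mono C0(2)) (auto simp: na)
      also have "\<dots> = ennreal (\<alpha> * (C0 * (norm w2)\<^sup>2 * q))"
        using \<alpha> by (simp add: ennreal_mult' q_def na power_divide flip: power_mult_distrib)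
      also have "\<alpha> * (C0 * (norm w2)\<^sup>2 * q) = C0 * q / (pi\<^sup>2 * norm z2) *
          (((norm w2)\<^sup>2 / 1\<^sup>2) powr c * (1 - (norm w2)\<^sup>2 / 1\<^sup>2) powr (-b) / (norm (1 - z2 * cnj w2))\<^sup>2)"
      proof -
        have "((norm w2)\<^sup>2) powr c = norm w2 powr e * norm w2"
        proof -
          have "((norm w2)\<^sup>2) powr c = (norm w2 powr 2) powr c"
            using that by simp
          also have "\<dots> = norm w2 powr (e + 1)"
            unfolding powr_powr c_def by (rule arg_cong[where f="(powr) (norm w2)"]) simp
          finally show ?thesis
            using that by (simp add: powr_add)
        qed
        then show ?thesis
          using that by (simp add: \<alpha>_def power2_eq_square[of "norm w2"] mult_ac)
      qed
      finally show ?thesis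
        using True by (subst (asm) ennreal_mult') (use C0(1) in \<open>auto simp: q_def\<close>)
    qed
    have "(\<integral>\<^sup>+w. F w \<partial>lborel) = (\<integral>\<^sup>+w. F w \<partial>(lborel \<Otimes>\<^sub>M lborel))"
      by (simp add: lborel_prod)
    also have "\<dots> = (\<integral>\<^sup>+w2. \<integral>\<^sup>+w1. F (w1, w2) \<partial>lborel \<partial>lborel)"
      using F by (subst lborel_pair.nn_integral_snd[symmetric]) (auto simp: lborel_prod)
    also have "\<dots> \<le> (\<integral>\<^sup>+w2. ennreal (C0 * q / (pi\<^sup>2 * norm z2)) *
        (ennreal (((norm w2)\<^sup>2 / 1\<^sup>2) powr c * (1 - (norm w2)\<^sup>2 / 1\<^sup>2) powr (-b) / (norm (1 - z2 * cnj w2))\<^sup>2) * indicator (ball 0 1) w2) \<partial>lborel)"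
      using AE_lborel_singleton[of "0::complex"] inner
      by (intro nn_integral_mono_AE) (auto elim!: eventually_mono)
    also have "\<dots> = ennreal (C0 * q / (pi\<^sup>2 * norm z2)) * (\<integral>\<^sup>+w2\<in>ball 0 1.
        ennreal (((norm w2)\<^sup>2 / 1\<^sup>2) powr c * (1 - (norm w2)\<^sup>2 / 1\<^sup>2) powr (-b) / (norm (1 - z2 * cnj w2))\<^sup>2) \<partial>lborel)"
      by (rule nn_integral_cmult) measurable
    also have "\<dots> \<le> ennreal (C0 * q / (pi\<^sup>2 * norm z2)) * ennreal (C1 * 1\<^sup>2 * (1 - (norm z2)\<^sup>2 * 1\<^sup>2) powr (-b))"
      using z by (intro mult_left_mono C1(2)) auto
    also have "\<dots> = ennreal (C0 * C1 / pi\<^sup>2 * hartogs_weight (-1) b z)"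
      using C0 C1 z2 by (simp add: ennreal_mult'[symmetric] q_def hartogs_weight_def z powr_minus field_simps)
    finally show "(\<integral>\<^sup>+w\<in>hartogs. ennreal (norm (hartogs_kernel z w) * hartogs_weight e b w) \<partial>lborel)
        \<le> ennreal (C0 * C1 / pi\<^sup>2 * hartogs_weight (-1) b z)"
      unfolding F_def .
  qed
qed

section \<open>Reduction to Borel functions and to nonnegative integrals\<close>

lemma lebesgue_on_ex_borel:
  fixes f :: "complex \<times> complex \<Rightarrow> complex"
  assumes f: "f \<in> borel_measurable (lebesgue_on S)" and S: "S \<in> sets lebesgue"
  obtains g where "g \<in> borel_measurable borel" "AE w in lborel. w \<in> S \<longrightarrow> f w = g w"
proof -
  have f': "(\<lambda>w. indicator S w *\<^sub>R f w) \<in> borel_measurable lebesgue"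
    using f S by (simp add: borel_measurable_restrict_space_iff)
  have "(\<lambda>w. Re (indicator S w *\<^sub>R f w)) \<in> borel_measurable lebesgue"
    using f' by (rule measurable_compose) simp
  then obtain u where u: "u \<in> borel_measurable lborel" "AE w in lborel. Re (indicator S w *\<^sub>R f w) = u w"
    using completion_ex_borel_measurable_real by blast
  have "(\<lambda>w. Im (indicator S w *\<^sub>R f w)) \<in> borel_measurable lebesgue"
    using f' by (rule measurable_compose) simp
  then obtain v where v: "v \<in> borel_measurable lborel" "AE w in lborel. Im (indicator S w *\<^sub>R f w) = v w"
    using completion_ex_borel_measurable_real by blast
  show ?thesis
  proof (rule that)
    show "(\<lambda>w. Complex (u w) (v w)) \<in> borel_measurable borel"
      unfolding Complex_eq using u v by simp
    show "AE w in lborel. w \<in> S \<longrightarrow> f w = Complex (u w) (v w)"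
      using u(2) v(2) by eventually_elim (auto simp: complex_eq_iff)
  qed
qed

lemma measurable_hartogs_kernel' [measurable (raw)]:
  assumes [measurable]: "F \<in> borel_measurable N" "G \<in> borel_measurable N"
  shows "(\<lambda>x. hartogs_kernel (F x) (G x)) \<in> borel_measurable N"
proof -
  have "(\<lambda>x. (\<lambda>(z, w). hartogs_kernel z w) (F x, G x)) \<in> borel_measurable N"
    using measurable_hartogs_kernel by measurable
  then show ?thesis by simp
qed

text \<open>Changing \<open>f\<close> on a null set alters no value of the projection, and for a
  Borel integrand the completion gives the same integral. The equality holds for every
  \<open>z\<close>, so level sets are preserved exactly and Fubini can be used with
  \<open>g\<close>.\<close>

lemma bergman_proj_eq_borel:
  assumes f: "f \<in> borel_measurable (lebesgue_on hartogs)"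
    and [measurable]: "g \<in> borel_measurable borel" and fg: "AE w in lborel. w \<in> hartogs \<longrightarrow> f w = g w"
  shows "bergman_proj f z = set_lebesgue_integral lborel hartogs (\<lambda>w. hartogs_kernel z w * g w)"
proof -
  have meas: "(\<lambda>w. indicator hartogs w *\<^sub>R (hartogs_kernel z w * g w)) \<in> borel_measurable lborel"
    by measurable
  have f': "(\<lambda>w. indicator hartogs w *\<^sub>R f w) \<in> borel_measurable lebesgue"
    using f by (simp add: borel_measurable_restrict_space_iff)
  have K: "(\<lambda>w. hartogs_kernel z w) \<in> borel_measurable lebesgue"
    by (rule measurable_completion) measurable
  have "(\<lambda>w. hartogs_kernel z w * (indicator hartogs w *\<^sub>R f w)) \<in> borel_measurable lebesgue"
    using f' K by (rule borel_measurable_times[rotated])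
  then have "(\<lambda>w. indicator hartogs w *\<^sub>R (hartogs_kernel z w * f w)) \<in> borel_measurable lebesgue"
    by simp
  then have "bergman_proj f z = (LINT w|lebesgue. indicator hartogs w *\<^sub>R (hartogs_kernel z w * g w))"
    unfolding bergman_proj_def set_lebesgue_integral_def
    using measurable_completion[OF meas] AE_completion[OF fg]
    by (intro integral_cong_AE) (auto elim!: eventually_mono simp: indicator_def)
  also have "\<dots> = set_lebesgue_integral lborel hartogs (\<lambda>w. hartogs_kernel z w * g w)"
    unfolding set_lebesgue_integral_def by (rule integral_completion[OF meas])
  finally show ?thesis .
qed

text \<open>Without integrability the integral on the left is \<open>0\<close> by convention, so the
  bound applies to the projection at every point without a proof of convergence.\<close>

lemma norm_set_lebesgue_integral_le:
  fixes f :: "'a \<Rightarrow> 'b :: {banach, second_countable_topology}"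
  shows "ennreal (norm (set_lebesgue_integral M A f)) \<le> (\<integral>\<^sup>+x\<in>A. ennreal (norm (f x)) \<partial>M)"
proof (cases "set_integrable M A f")
  case True
  then have "ennreal (norm (set_lebesgue_integral M A f)) \<le> (\<integral>\<^sup>+x. ennreal (norm (indicator A x *\<^sub>R f x)) \<partial>M)"
    unfolding set_lebesgue_integral_def set_integrable_def by (rule integral_norm_bound_ennreal)
  also have "\<dots> = (\<integral>\<^sup>+x\<in>A. ennreal (norm (f x)) \<partial>M)"
    by (intro nn_integral_cong) (simp split: split_indicator)
  finally show ?thesis .
next
  case False
  then show ?thesis
    by (simp add: set_lebesgue_integral_def set_integrable_def not_integrable_integral_eq)
qed

theorem theorem4p6:
  fixes \<epsilon> :: real
  assumes "\<epsilon> > 0"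
  shows "\<exists>C > 0. \<forall>(f :: complex \<times> complex \<Rightarrow> complex) (lam :: real).
           f \<in> borel_measurable (lebesgue_on hartogs)
         \<and> weighted_Lp_pow (4/3) (\<lambda>w. norm (snd w) powr (- \<epsilon>)) f < \<infinity>
         \<and> lam > 0
         \<longrightarrow> {z \<in> hartogs. norm (bergman_proj f z) > lam} \<in> sets lebesgue
           \<and> emeasure lebesgue {z \<in> hartogs. norm (bergman_proj f z) > lam}
               \<le> ennreal C * weighted_Lp_pow (4/3) (\<lambda>w. norm (snd w) powr (- \<epsilon>)) f
                   / ennreal (lam powr (4/3))"
proof -
  \<comment> \<open>The exponent of \<open>h\<close> is the one for which \<open>h powr (1/3) * v\<close> again has the factor
    \<open>norm (snd w) powr (-1)\<close>, and \<open>\<epsilon> > 0\<close> is what makes it exceed \<open>-3\<close>.\<close>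
  define v :: "complex \<times> complex \<Rightarrow> real" where "v w = norm (snd w) powr (- \<epsilon>)" for w
  define h where "h = hartogs_weight (3 * \<epsilon> - 3) (1/2)"
  \<comment> \<open>This is the weight returned by the estimate for \<open>h\<close>. Its power
    \<open>4/3 - 1\<close> has exponents \<open>-1/3\<close> and \<open>1/6\<close>, again
    admissible since \<open>-1/3 > -3\<close> and \<open>0 < 1/6 < 1\<close>.\<close>
  define k where "k = hartogs_weight (-1) (1/2)"
  obtain A where A: "A > 0"
    "\<And>z. z \<in> hartogs \<Longrightarrow> (\<integral>\<^sup>+w\<in>hartogs. ennreal (norm (hartogs_kernel z w) * h w) \<partial>lborel) \<le> ennreal (A * k z)"
    by (rule hartogs_forelli_rudin[of "1/2" "3 * \<epsilon> - 3", folded h_def k_def]) (use assms in simp, use assms in simp, use assms in simp, rule that)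
  obtain B where B: "B > 0"
    "\<And>w. w \<in> hartogs \<Longrightarrow> (\<integral>\<^sup>+z\<in>hartogs. ennreal (norm (hartogs_kernel w z) * hartogs_weight (-1/3) (1/6) z) \<partial>lborel)
        \<le> ennreal (B * hartogs_weight (-1) (1/6) w)"
    by (rule hartogs_forelli_rudin[of "1/6" "-1/3"]) (simp, simp, simp, rule that)
  have v: "v \<in> borel_measurable borel"
    unfolding v_def borel_prod[symmetric] by measurable
  have hv: "h w powr (4/3 - 1) * v w = hartogs_weight (-1) (1/6) w" for w
  proof -
    have "norm (snd w) powr ((3 * \<epsilon> - 3) * (1/3)) * norm (snd w) powr (- \<epsilon>) = norm (snd w) powr (-1)"
      by (simp add: powr_add[symmetric] algebra_simps)
    moreover have "h w powr (4/3 - 1) * v w = norm (snd w) powr ((3 * \<epsilon> - 3) * (1/3)) * norm (snd w) powr (- \<epsilon>)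
        * ((1 - (norm (fst w))\<^sup>2 / (norm (snd w))\<^sup>2) powr - (1/6) * (1 - (norm (snd w))\<^sup>2) powr - (1/6))"
      by (simp only: h_def v_def hartogs_weight_powr) (simp add: hartogs_weight_def mult_ac)
    ultimately show ?thesis
      by (simp only: hartogs_weight_def)
  qed
  have k': "k z powr (4/3 - 1) = hartogs_weight (-1/3) (1/6) z" for z
    by (simp add: k_def hartogs_weight_powr)
  have Kk: "(\<integral>\<^sup>+z\<in>hartogs. ennreal (norm (hartogs_kernel z w) * k z powr (4/3 - 1)) \<partial>lborel)
      \<le> ennreal (B * h w powr (4/3 - 1) * v w)" if "w \<in> hartogs" for w
    using B(2)[OF that] by (simp only: hv k' mult.assoc norm_hartogs_kernel_commute[of _ w])
  define C where "C = A powr (4/3 - 1) * B"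
  have "C > 0"
    using A B by (simp add: C_def)
  moreover have "{z \<in> hartogs. norm (bergman_proj f z) > lam} \<in> sets lebesgue
           \<and> emeasure lebesgue {z \<in> hartogs. norm (bergman_proj f z) > lam}
               \<le> ennreal C * weighted_Lp_pow (4/3) v f / ennreal (lam powr (4/3))"
    if f: "f \<in> borel_measurable (lebesgue_on hartogs)" and lam: "lam > 0" for f lam
  proof -
    obtain g where g [measurable]: "g \<in> borel_measurable borel"
      and fg: "AE w in lborel. w \<in> hartogs \<longrightarrow> f w = g w"
      using lebesgue_on_ex_borel[OF f] by auto
    define P where "P z = set_lebesgue_integral lborel hartogs (\<lambda>w. hartogs_kernel z w * g w)" for z
    have Pf: "bergman_proj f = P"
      by (rule ext) (simp add: P_def bergman_proj_eq_borel[OF f g fg])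
    have [measurable]: "P \<in> borel_measurable borel"
      unfolding P_def set_lebesgue_integral_def by measurable
    define E where "E = {z \<in> hartogs. norm (P z) > lam}"
    have E: "E \<in> sets borel"
    proof -
      have "{z \<in> space borel. z \<in> hartogs \<and> norm (P z) > lam} \<in> sets borel"
        by measurable
      then show ?thesis by (simp add: E_def)
    qed
    \<comment> \<open>The level set of the positive operator with kernel
      \<open>norm (hartogs_kernel z w)\<close>, to which the Schur test applies; it contains the
      level set \<open>E\<close> of the projection.\<close>
    define E' where "E' = {z \<in> hartogs. (\<integral>\<^sup>+w\<in>hartogs. ennreal (norm (hartogs_kernel z w) * norm (g w)) \<partial>lborel) > ennreal lam}"
    have E': "E' \<in> sets lborel"
    proof -
      have "{z \<in> space lborel. z \<in> hartogs \<and> (\<integral>\<^sup>+w\<in>hartogs. ennreal (norm (hartogs_kernel z w) * norm (g w)) \<partial>lborel) > ennreal lam} \<in> sets lborel"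
        by measurable
      then show ?thesis by (simp add: E'_def)
    qed
    have "E \<subseteq> E'"
    proof
      fix z assume "z \<in> E"
      then have "z \<in> hartogs" "ennreal lam < ennreal (norm (P z))"
        using lam by (auto simp: E_def ennreal_less_iff)
      moreover have "ennreal (norm (P z)) \<le> (\<integral>\<^sup>+w\<in>hartogs. ennreal (norm (hartogs_kernel z w) * norm (g w)) \<partial>lborel)"
        unfolding P_def by (rule order_trans[OF norm_set_lebesgue_integral_le]) (simp add: norm_mult)
      ultimately show "z \<in> E'"
        by (auto simp: E'_def)
    qed
    have W: "weighted_Lp_pow (4/3) v f = (\<integral>\<^sup>+w\<in>hartogs. ennreal (norm (g w) powr (4/3) * v w) \<partial>lborel)"
      unfolding weighted_Lp_pow_def nn_integral_completion
      using fg by (intro nn_integral_cong_AE) (auto elim!: eventually_mono split: split_indicator)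
    have "ennreal (lam powr (4/3)) * emeasure lborel E \<le> ennreal (lam powr (4/3)) * emeasure lborel E'"
      using \<open>E \<subseteq> E'\<close> E' by (intro mult_left_mono emeasure_mono) auto
    also have "\<dots> \<le> ennreal C * weighted_Lp_pow (4/3) v f"
      unfolding W C_def E'_def
      by (rule schur_test_weak_type[where h = h and k = k])
        (use A B lam v Kk in \<open>auto simp: h_def k_def hartogs_weight_pos lborel.sigma_finite_measure_axioms\<close>)
    finally have "ennreal (lam powr (4/3)) * emeasure lborel E / ennreal (lam powr (4/3))
        \<le> ennreal C * weighted_Lp_pow (4/3) v f / ennreal (lam powr (4/3))"
      by (rule divide_right_mono_ennreal)
    then have "emeasure lborel E \<le> ennreal C * weighted_Lp_pow (4/3) v f / ennreal (lam powr (4/3))"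
      using lam by (simp add: mult.commute[of "ennreal (lam powr (4/3))"] mult_divide_eq_ennreal)
    moreover have "emeasure lebesgue E = emeasure lborel E" "E \<in> sets lebesgue"
      using E by auto
    ultimately show ?thesis
      by (simp add: Pf E_def)
  qed
  ultimately show ?thesis
    unfolding v_def by blast
qed

end
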